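(* Let $1<p<\infty$ and $0<\gamma<1$. The Riesz $(\gamma,p)$-capacity $\mathcal{C}_{\gamma,p}$ is an outer measure on $X$, that is: (a) $\mathcal{C}_{\gamma,p}(\emptyset)=0$; (b) if $A\subset B\subset X$, then $\mathcal{C}_{\gamma,p}(A)\le \mathcal{C}_{\gamma,p}(B)$; (c) for every sequence $\{A_i\}_{i=1}^\infty$ of subsets of $X$, $\mathcal{C}_{\gamma,p}\left(\bigcup_{i=1}^\infty A_i\right)\le\sum_{i=1}^\infty \mathcal{C}_{\gamma,p}(A_i)$.
   Context: Setting: $X=(X,d,\mu)$ is a locally compact metric space equipped with a Borel regular outer measure $\mu$ that is doubling, i.e. there is a constant $c_d\ge 1$ with $\mu(B(x,2r))\le c_d\,\mu(B(x,r))$ for every ball $B(x,r)=\{y\in X: d(y,x)<r\}$. Every open ball has positive and finite measure. Spheres have measure zero, $\mu(\{y\in X: d(x,y)=r\})=0$ for all $x\in X$, $r>0$, and points have measure zero, $\mu(\{x\})=0$ for all $x\in X$. For $0<\gamma<1$, the Riesz potential of order $\gamma$ of a measurable function $f$ is $$I_\gamma f(x)=\int_X \frac{f(y)}{\mu(B(x,d(x,y)))^{1-\gamma}}\,d\mu(y)$$ (the single point $y=x$ may be omitted from the domain of integration, since it is $\mu$-null). $L^p_+(X)$ denotes the set of non-negative functions in $L^p(X)=L^p(X,\mu)$. For $1<p<\infty$ and any $E\subset X$, the Riesz $(\gamma,p)$-capacity is $\mathcal{C}_{\gamma,p}(E)=\inf_{f\in\mathcal{A}(E)}\|f\|_{L^p(X)}^p$,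 where $\mathcal{A}(E)=\{f\in L^p_+(X): I_\gamma f\ge 1\text{ on }E\}$ and $\mathcal{C}_{\gamma,p}(E)=\infty$ if $\mathcal{A}(E)=\emptyset$. *)

theory Defs
  imports "HOL-Analysis.Analysis"
begin

text \<open>
  The outer measure is a function \<mu> on all subsets of the type. The library predicate
  \<^const>\<open>outer_measure_space\<close> asks for countable subadditivity along disjoint sequences only; on the
  full power set, together with monotonicity, this is equivalent to the usual condition for
  arbitrary sequences. The class of measurable sets is that of Caratheodory.
\<close>

abbreviation caratheodory_sets :: "('a set \<Rightarrow> ennreal) \<Rightarrow> 'a set set" where
  "caratheodory_sets \<mu> \<equiv> lambda_system UNIV (Pow UNIV) \<mu>"

definition caratheodory_measure :: "('a set \<Rightarrow> ennreal) \<Rightarrow> 'a measure" where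
  "caratheodory_measure \<mu> = measure_of UNIV (caratheodory_sets \<mu>) \<mu>"

definition borel_regular_outer_measure :: "('a::topological_space set \<Rightarrow> ennreal) \<Rightarrow> bool" where
  "borel_regular_outer_measure \<mu> \<longleftrightarrow>
     outer_measure_space (Pow UNIV) \<mu> \<and>
     sets borel \<subseteq> caratheodory_sets \<mu> \<and>
     (\<forall>A. \<exists>B\<in>sets borel. A \<subseteq> B \<and> \<mu> B = \<mu> A)"

definition doubling :: "('a::metric_space set \<Rightarrow> ennreal) \<Rightarrow> bool" where
  "doubling \<mu> \<longleftrightarrow>
     (\<exists>c::real. c \<ge> 1 \<and> (\<forall>x. \<forall>r>0. \<mu> (ball x (2 * r)) \<le> ennreal c * \<mu> (ball x r)))"

definition Lp_plus :: "real \<Rightarrow> ('a set \<Rightarrow> ennreal) \<Rightarrow> ('a \<Rightarrow> real) set" where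
  "Lp_plus p \<mu> = {f \<in> borel_measurable (caratheodory_measure \<mu>).
     (\<forall>x. 0 \<le> f x) \<and> (\<integral>\<^sup>+x. ennreal (\<bar>f x\<bar> powr p) \<partial>caratheodory_measure \<mu>) < \<infinity>}"

text \<open>Meaningful only for \<open>f\<close> with finite \<open>p\<close>-th moment, as in \<^const>\<open>Lp_plus\<close>.\<close>

definition Lp_norm :: "real \<Rightarrow> ('a set \<Rightarrow> ennreal) \<Rightarrow> ('a \<Rightarrow> real) \<Rightarrow> real" where
  "Lp_norm p \<mu> f =
     enn2real (\<integral>\<^sup>+x. ennreal (\<bar>f x\<bar> powr p) \<partial>caratheodory_measure \<mu>) powr (1 / p)"

text \<open>
  The potential of a non-negative \<open>f\<close>, with values in \<open>[0, \<infinity>]\<close> (negative values of \<open>f\<close> would be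
  cut off at 0). At \<open>y = x\<close> the ball is empty and the integrand is \<open>\<infinity>\<close> or 0; this does not
  matter when points are null.
\<close>

definition riesz_potential ::
    "real \<Rightarrow> ('a::metric_space set \<Rightarrow> ennreal) \<Rightarrow> ('a \<Rightarrow> real) \<Rightarrow> 'a \<Rightarrow> ennreal" where
  "riesz_potential \<gamma> \<mu> f x =
     (\<integral>\<^sup>+y. ennreal (f y) / ennreal (enn2real (\<mu> (ball x (dist x y))) powr (1 - \<gamma>))
        \<partial>caratheodory_measure \<mu>)"

definition riesz_admissible ::
    "real \<Rightarrow> real \<Rightarrow> ('a::metric_space set \<Rightarrow> ennreal) \<Rightarrow> 'a set \<Rightarrow> ('a \<Rightarrow> real) set" where
  "riesz_admissible \<gamma> p \<mu> E = {f \<in> Lp_plus p \<mu>. \<forall>x\<in>E. riesz_potential \<gamma> \<mu> f x \<ge> 1}"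

text \<open>If no function is admissible, the infimum in \<^typ>\<open>ennreal\<close> is \<open>\<infinity>\<close>.\<close>

definition riesz_capacity ::
    "real \<Rightarrow> real \<Rightarrow> ('a::metric_space set \<Rightarrow> ennreal) \<Rightarrow> 'a set \<Rightarrow> ennreal" where
  "riesz_capacity \<gamma> p \<mu> E = (INF f\<in>riesz_admissible \<gamma> p \<mu> E. ennreal (Lp_norm p \<mu> f powr p))"

end

theory Submission
  imports Defs
begin

text \<open>
  Only countable subadditivity needs an idea. Take \<open>f i\<close> admissible for \<open>A i\<close> and nearly optimal, and
  put \<open>g = (\<Sum>i. f i ^ p) ^ (1 / p)\<close>. Then \<open>g\<close> dominates every \<open>f i\<close>, so its potential, which is
  monotone, is at least 1 on each \<open>A i\<close>; and \<open>\<integral> g ^ p = (\<Sum>i. \<integral> f i ^ p)\<close> by monotone convergence,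
  so the cost of \<open>g\<close> is the sum of the costs of the \<open>f i\<close>. (The pointwise supremum of the \<open>f i\<close> would
  serve equally well.) The series may diverge at some points, where a real-valued \<open>g\<close> cannot
  dominate. If the total cost is finite these points form a null set, and potentials do not see it.
  If the total cost is infinite there is nothing to prove.
\<close>

lemma ennreal_Lp_norm_powr:
  assumes "f \<in> Lp_plus p \<mu>" "0 < p"
  shows "ennreal (Lp_norm p \<mu> f powr p)
    = (\<integral>\<^sup>+x. ennreal (\<bar>f x\<bar> powr p) \<partial>caratheodory_measure \<mu>)"
proof -
  have "(\<integral>\<^sup>+x. ennreal (\<bar>f x\<bar> powr p) \<partial>caratheodory_measure \<mu>) < top"
    using assms(1) unfolding Lp_plus_def infinity_ennreal_def by blast
  then show ?thesis
    unfolding Lp_norm_def using assms(2) by (simp add: powr_powr)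
qed

lemma riesz_potential_mono_AE:
  assumes "AE y in caratheodory_measure \<mu>. f y \<le> g y"
  shows "riesz_potential \<gamma> \<mu> f x \<le> riesz_potential \<gamma> \<mu> g x"
  unfolding riesz_potential_def
proof (rule nn_integral_mono_AE, use assms in eventually_elim)
  case (elim y)
  then show ?case
    by (intro divide_right_mono_ennreal ennreal_leI)
qed

lemma riesz_capacity_le:
  assumes "f \<in> riesz_admissible \<gamma> p \<mu> E" "0 < p"
  shows "riesz_capacity \<gamma> p \<mu> E
    \<le> (\<integral>\<^sup>+x. ennreal (\<bar>f x\<bar> powr p) \<partial>caratheodory_measure \<mu>)"
proof -
  have "f \<in> Lp_plus p \<mu>"
    using assms(1) by (simp add: riesz_admissible_def)
  then show ?thesis
    unfolding riesz_capacity_def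
    using INF_lower[OF assms(1), of "\<lambda>f. ennreal (Lp_norm p \<mu> f powr p)"] assms(2)
    by (simp add: ennreal_Lp_norm_powr)
qed

lemma riesz_capacity_lessD:
  assumes "riesz_capacity \<gamma> p \<mu> E < c" "0 < p"
  obtains f where "f \<in> riesz_admissible \<gamma> p \<mu> E"
    and "(\<integral>\<^sup>+x. ennreal (\<bar>f x\<bar> powr p) \<partial>caratheodory_measure \<mu>) < c"
proof -
  obtain f where f: "f \<in> riesz_admissible \<gamma> p \<mu> E" "ennreal (Lp_norm p \<mu> f powr p) < c"
    using assms(1) by (auto simp: riesz_capacity_def INF_less_iff)
  moreover have "f \<in> Lp_plus p \<mu>"
    using f(1) by (simp add: riesz_admissible_def)
  ultimately show thesis
    using that assms(2) by (simp add: ennreal_Lp_norm_powr)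
qed

lemma riesz_capacity_empty:
  assumes "0 < p"
  shows "riesz_capacity \<gamma> p \<mu> {} = 0"
proof -
  have "(\<lambda>_. 0) \<in> riesz_admissible \<gamma> p \<mu> {}"
    by (simp add: riesz_admissible_def Lp_plus_def)
  from riesz_capacity_le[OF this assms] show ?thesis
    by simp
qed

lemma riesz_capacity_mono:
  assumes "A \<subseteq> B"
  shows "riesz_capacity \<gamma> p \<mu> A \<le> riesz_capacity \<gamma> p \<mu> B"
  unfolding riesz_capacity_def
  by (rule INF_superset_mono) (use assms in \<open>auto simp: riesz_admissible_def\<close>)

text \<open>
  The common majorant is the \<open>\<ell>\<^sup>p\<close> norm of the sequence \<open>f i y\<close>: unlike the sum of the \<open>f i\<close>, it costs
  no more than the \<open>f i\<close> together, with no constant lost.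
\<close>

lemma Lp_plus_countable_majorant:
  fixes f :: "nat \<Rightarrow> 'a \<Rightarrow> real"
  assumes f: "\<And>i. f i \<in> Lp_plus p \<mu>" and p: "0 < p"
    and fin: "(\<Sum>i. \<integral>\<^sup>+x. ennreal (\<bar>f i x\<bar> powr p) \<partial>caratheodory_measure \<mu>) < \<infinity>"
  obtains g where "g \<in> Lp_plus p \<mu>"
    and "\<And>i. AE x in caratheodory_measure \<mu>. f i x \<le> g x"
    and "(\<integral>\<^sup>+x. ennreal (\<bar>g x\<bar> powr p) \<partial>caratheodory_measure \<mu>)
      \<le> (\<Sum>i. \<integral>\<^sup>+x. ennreal (\<bar>f i x\<bar> powr p) \<partial>caratheodory_measure \<mu>)"
proof -
  let ?M = "caratheodory_measure \<mu>"
  have meas [measurable]: "f i \<in> borel_measurable ?M" for i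
    using f[of i] by (simp add: Lp_plus_def)
  define F where "F = (\<lambda>x. \<Sum>i. ennreal (\<bar>f i x\<bar> powr p))"
  define g where "g = (\<lambda>x. enn2real (F x) powr (1 / p))"
  have F_meas [measurable]: "F \<in> borel_measurable ?M"
    unfolding F_def by measurable
  have g_meas: "g \<in> borel_measurable ?M"
    unfolding g_def by measurable
  have F_int: "(\<integral>\<^sup>+x. F x \<partial>?M) = (\<Sum>i. \<integral>\<^sup>+x. ennreal (\<bar>f i x\<bar> powr p) \<partial>?M)"
    unfolding F_def by (rule nn_integral_suminf) measurable
  \<comment> \<open>Only an inequality: where the series diverges, the left-hand side is 0.\<close>
  have "ennreal (\<bar>g x\<bar> powr p) \<le> F x" for x
    using p by (cases "F x") (auto simp: g_def powr_powr)
  then have g_int: "(\<integral>\<^sup>+x. ennreal (\<bar>g x\<bar> powr p) \<partial>?M)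
      \<le> (\<Sum>i. \<integral>\<^sup>+x. ennreal (\<bar>f i x\<bar> powr p) \<partial>?M)"
    unfolding F_int[symmetric] by (intro nn_integral_mono)
  have F_fin: "AE x in ?M. F x \<noteq> \<infinity>"
    by (rule nn_integral_PInf_AE) (use fin F_int in auto)
  have dom: "AE x in ?M. f i x \<le> g x" for i
    using F_fin
  proof eventually_elim
    case (elim x)
    have "(\<Sum>j\<in>{i}. ennreal (\<bar>f j x\<bar> powr p)) \<le> F x"
      unfolding F_def by (rule sum_le_suminf) auto
    then have "ennreal (\<bar>f i x\<bar> powr p) \<le> F x"
      by simp
    with elim have "\<bar>f i x\<bar> powr p \<le> enn2real (F x)"
      by (cases "F x") auto
    then have "(\<bar>f i x\<bar> powr p) powr (1 / p) \<le> g x"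
      unfolding g_def using p by (intro powr_mono2) auto
    then show ?case
      using p by (simp add: powr_powr)
  qed
  have "g \<in> Lp_plus p \<mu>"
    using g_meas g_int fin by (auto simp: Lp_plus_def g_def)
  then show thesis
    using dom g_int by (rule that)
qed

lemma riesz_capacity_countably_subadditive:
  fixes A :: "nat \<Rightarrow> 'a::metric_space set"
  assumes p: "0 < p"
  shows "riesz_capacity \<gamma> p \<mu> (\<Union>i. A i) \<le> (\<Sum>i. riesz_capacity \<gamma> p \<mu> (A i))"
proof (rule ennreal_le_epsilon)
  let ?M = "caratheodory_measure \<mu>" and ?C = "riesz_capacity \<gamma> p \<mu>"
  fix e :: real
  assume sum_fin: "(\<Sum>i. ?C (A i)) < top" and e: "0 < e"
  have C_fin: "?C (A i) < top" for i
    using sum_le_suminf[of "\<lambda>i. ?C (A i)" "{i}"] sum_fin by (simp add: order_le_less_trans)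
  have "\<exists>h\<in>riesz_admissible \<gamma> p \<mu> (A i).
      (\<integral>\<^sup>+x. ennreal (\<bar>h x\<bar> powr p) \<partial>?M) < ?C (A i) + ennreal (e * (1 / 2) ^ Suc i)" for i
  proof -
    have "?C (A i) < ?C (A i) + ennreal (e * (1 / 2) ^ Suc i)"
      using C_fin[of i] e
      by (cases "?C (A i)") (auto simp: ennreal_less_iff simp flip: ennreal_plus)
    from riesz_capacity_lessD[OF this p] show ?thesis
      by blast
  qed
  then obtain f where f: "\<And>i. f i \<in> riesz_admissible \<gamma> p \<mu> (A i)"
    and f_less: "\<And>i. (\<integral>\<^sup>+x. ennreal (\<bar>f i x\<bar> powr p) \<partial>?M)
      < ?C (A i) + ennreal (e * (1 / 2) ^ Suc i)"
    by metis
  have "(\<Sum>i. \<integral>\<^sup>+x. ennreal (\<bar>f i x\<bar> powr p) \<partial>?M)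
      \<le> (\<Sum>i. ?C (A i) + ennreal (e * (1 / 2) ^ Suc i))"
    using f_less by (intro suminf_le) (auto intro: less_imp_le)
  also have "\<dots> = (\<Sum>i. ?C (A i)) + (\<Sum>i. ennreal (e * (1 / 2) ^ Suc i))"
    by (intro suminf_add[symmetric]) auto
  also have "(\<Sum>i. ennreal (e * (1 / 2) ^ Suc i)) = ennreal e"
    using e sums_mult[OF power_half_series, of e] by (intro suminf_ennreal_eq) auto
  finally have total: 
    "(\<Sum>i. \<integral>\<^sup>+x. ennreal (\<bar>f i x\<bar> powr p) \<partial>?M) \<le> (\<Sum>i. ?C (A i)) + ennreal e" .
  then have "(\<Sum>i. \<integral>\<^sup>+x. ennreal (\<bar>f i x\<bar> powr p) \<partial>?M) < \<infinity>"
    using sum_fin by (auto intro: order_le_less_trans)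
  moreover have "\<And>i. f i \<in> Lp_plus p \<mu>"
    using f by (simp add: riesz_admissible_def)
  ultimately obtain g where g: "g \<in> Lp_plus p \<mu>"
    and dom: "\<And>i. AE x in ?M. f i x \<le> g x"
    and g_int: "(\<integral>\<^sup>+x. ennreal (\<bar>g x\<bar> powr p) \<partial>?M)
      \<le> (\<Sum>i. \<integral>\<^sup>+x. ennreal (\<bar>f i x\<bar> powr p) \<partial>?M)"
    using Lp_plus_countable_majorant[of f p \<mu>] p by blast
  have "1 \<le> riesz_potential \<gamma> \<mu> g x" if "x \<in> A i" for x i
  proof -
    have "1 \<le> riesz_potential \<gamma> \<mu> (f i) x"
      using f[of i] that by (simp add: riesz_admissible_def)
    also have "\<dots> \<le> riesz_potential \<gamma> \<mu> g x"
      by (rule riesz_potential_mono_AE) (rule dom)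
    finally show ?thesis .
  qed
  then have "g \<in> riesz_admissible \<gamma> p \<mu> (\<Union>i. A i)"
    using g by (auto simp: riesz_admissible_def)
  from riesz_capacity_le[OF this p] g_int total
  show "?C (\<Union>i. A i) \<le> (\<Sum>i. ?C (A i)) + ennreal e"
    by order
qed

theorem theorem3p2:
  fixes \<mu> :: "'a::metric_space set \<Rightarrow> ennreal" and p \<gamma> :: real
  assumes "locally compact (UNIV :: 'a set)"
    and "borel_regular_outer_measure \<mu>"
    and "doubling \<mu>"
    and "\<And>x r. r > 0 \<Longrightarrow> 0 < \<mu> (ball x r) \<and> \<mu> (ball x r) < \<infinity>"
    and "\<And>x r. r > 0 \<Longrightarrow> \<mu> (sphere x r) = 0"
    and "\<And>x. \<mu> {x} = 0"
    and "1 < p" and "0 < \<gamma>" and "\<gamma> < 1"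
  shows "riesz_capacity \<gamma> p \<mu> {} = 0
    \<and> (\<forall>A B. A \<subseteq> B \<longrightarrow> riesz_capacity \<gamma> p \<mu> A \<le> riesz_capacity \<gamma> p \<mu> B)
    \<and> (\<forall>A :: nat \<Rightarrow> 'a set.
          riesz_capacity \<gamma> p \<mu> (\<Union>i. A i) \<le> (\<Sum>i. riesz_capacity \<gamma> p \<mu> (A i)))"
  using \<open>1 < p\<close>
  by (intro conjI allI impI riesz_capacity_empty riesz_capacity_mono
      riesz_capacity_countably_subadditive) auto

end
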